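(* Let $(X,\mu,\mathcal{E},\mathcal{F})$ be a Dirichlet space with conservative heat semigroup $\{P_t\}_{t\in[0,\infty)}$, and let $p\ge 1$. Assume: (1) $P_t$ admits a measurable heat kernel $p_t(x,y)$ satisfying, for some $C>0$ and $\beta>0$, $$p_t(x,y)\le C t^{-\beta}$$ for $\mu\times\mu$-a.e. $(x,y)\in X\times X$ and each $t\in(0,+\infty)$. (2) There exist $\alpha>0$ and $C>0$ such that for every $f\in L^p(X,\mu)$, $$\|f\|_{p,\alpha}\le C\liminf_{t\to 0} t^{-\alpha}\left(\int_X\int_X |f(x)-f(y)|^p p_t(x,y)\,d\mu(x)\,d\mu(y)\right)^{1/p},$$ where $$\|f\|_{p,\alpha}:=\sup_{t>0}t^{-\alpha}\left(\int_X\int_X |f(x)-f(y)|^p p_t(x,y)\,d\mu(x)\,d\mu(y)\right)^{1/p}\in[0,+\infty].$$ Then, if $0<\alpha<\beta$ and $p<\frac{\beta}{\alpha}$, there exists a constant $C_{p,\alpha,\beta}>0$ such that for every $f\in L^p(X,\mu)$, $$\|f\|_{L^q(X,\mu)}\le C_{p,\alpha,\beta}\|f\|_{p,\alpha},\qquad q=\frac{p\beta}{\beta-p\alpha}.$$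
   Context: $X$ is a good measurable space (the measure decomposition theorem holds and the $\sigma$-algebra is generated by a countable family; e.g. a Polish space) with a $\sigma$-finite measure $\mu$. A Dirichlet form is a densely defined closed symmetric form $(\mathcal{E},\mathcal{F})$ on $L^2(X,\mu)$ which is Markovian: if $u\in\mathcal F$ and $v$ satisfies $|v(x)-v(y)|\le|u(x)-u(y)|$ and $|v(x)|\le|u(x)|$ for a.e. $x,y$, then $v\in\mathcal F$ and $\mathcal E(v,v)\le\mathcal E(u,u)$. Then $(X,\mu,\mathcal E,\mathcal F)$ is called a Dirichlet space. $\{P_t\}_{t\ge0}$ is the associated self-adjoint sub-Markovian semigroup on $L^2(X,\mu)$ (the heat semigroup), extended to a contraction semigroup on every $L^p(X,\mu)$, $1\le p\le\infty$. It is conservative if $P_t1=1$ for all $t$. It admits a heat kernel if there is a measurable function $(t,x,y)\mapsto p_t(x,y)\ge0$ on $(0,\infty)\times X\times X$ such that $P_tf(x)=\int_X p_t(x,y)f(y)\,d\mu(y)$ for all $t>0$ and $f\in L^p(X,\mu)$, $1\le p\le\infty$. *)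

theory Defs
  imports "HOL-Probability.Probability"
begin

section \<open>Lebesgue spaces\<close>

text \<open>Powers with a positive real exponent on \<open>[0,\<infinity>]\<close>; the intended exponents are \<open>r > 0\<close>,
  so that \<open>\<infinity>\<close> is mapped to \<open>\<infinity>\<close>.\<close>

definition enn_powr :: "ennreal \<Rightarrow> real \<Rightarrow> ennreal" where
  "enn_powr x r = (if x = \<infinity> then \<infinity> else ennreal (enn2real x powr r))"

text \<open>The exponent ranges over \<open>[1,\<infinity>]\<close>. Elements of \<open>L\<^sup>p\<close> are represented by measurable functions,
  so equality in \<open>L\<^sup>p\<close> is equality almost everywhere.\<close>

definition Lp_norm :: "'a measure \<Rightarrow> ennreal \<Rightarrow> ('a \<Rightarrow> real) \<Rightarrow> ennreal" where
  "Lp_norm M p f =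
     (if p = \<infinity> then esssup M (\<lambda>x. ennreal \<bar>f x\<bar>)
      else enn_powr (\<integral>\<^sup>+x. ennreal (\<bar>f x\<bar> powr enn2real p) \<partial>M) (1 / enn2real p))"

definition Lp :: "'a measure \<Rightarrow> ennreal \<Rightarrow> ('a \<Rightarrow> real) set" where
  "Lp M p = {f \<in> borel_measurable M. Lp_norm M p f < \<infinity>}"

section \<open>Dirichlet spaces\<close>

text \<open>A countably generated \<open>\<sigma>\<close>-algebra for which the measure decomposition theorem holds: every
  probability measure \<open>\<nu>\<close> on \<open>X \<times> X\<close> decomposes as \<open>\<nu>(dx,dy) = k(x,dy) \<nu>\<^sub>1(dx)\<close>, where \<open>\<nu>\<^sub>1\<close>
  is its first marginal and \<open>k\<close> is a probability kernel. Only \<open>space M\<close> and \<open>sets M\<close> matter.\<close>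

definition good_measurable_space :: "'a measure \<Rightarrow> bool" where
  "good_measurable_space M \<longleftrightarrow>
     (\<exists>G. countable G \<and> G \<subseteq> Pow (space M) \<and> sets M = sigma_sets (space M) G) \<and>
     (\<forall>\<nu>. prob_space \<nu> \<and> sets \<nu> = sets (M \<Otimes>\<^sub>M M) \<longrightarrow>
        (\<exists>k \<in> M \<rightarrow>\<^sub>M prob_algebra M. \<forall>A\<in>sets M. \<forall>B\<in>sets M.
           emeasure \<nu> (A \<times> B) = (\<integral>\<^sup>+x\<in>A. emeasure (k x) B \<partial>(distr \<nu> M fst))))"

text \<open>The first four conjuncts and the eighth one say that \<open>F\<close> is (the preimage of) a linear
  subspace of \<open>L\<^sup>2\<close> on whose almost everywhere classes \<open>E\<close> is well defined.\<close>

definition symmetric_form ::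
  "'a measure \<Rightarrow> (('a \<Rightarrow> real) \<Rightarrow> ('a \<Rightarrow> real) \<Rightarrow> real) \<Rightarrow> ('a \<Rightarrow> real) set \<Rightarrow> bool" where
  "symmetric_form M E F \<longleftrightarrow>
     F \<subseteq> Lp M 2 \<and>
     (\<lambda>_. 0) \<in> F \<and>
     (\<forall>u\<in>F. \<forall>v\<in>F. \<forall>a b. (\<lambda>x. a * u x + b * v x) \<in> F) \<and>
     (\<forall>u\<in>F. \<forall>v\<in>borel_measurable M. (AE x in M. u x = v x) \<longrightarrow> v \<in> F) \<and>
     (\<forall>u\<in>F. \<forall>v\<in>F. \<forall>w\<in>F. \<forall>a b. E (\<lambda>x. a * u x + b * v x) w = a * E u w + b * E v w) \<and>
     (\<forall>u\<in>F. \<forall>v\<in>F. E u v = E v u) \<and>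
     (\<forall>u\<in>F. 0 \<le> E u u) \<and>
     (\<forall>u\<in>F. \<forall>v\<in>F. \<forall>w\<in>F. (AE x in M. u x = v x) \<longrightarrow> E u w = E v w)"

definition densely_defined :: "'a measure \<Rightarrow> ('a \<Rightarrow> real) set \<Rightarrow> bool" where
  "densely_defined M F \<longleftrightarrow>
     (\<forall>f\<in>Lp M 2. \<forall>\<epsilon>>0. \<exists>u\<in>F. Lp_norm M 2 (\<lambda>x. f x - u x) < ennreal \<epsilon>)"

definition form_energy ::
  "'a measure \<Rightarrow> (('a \<Rightarrow> real) \<Rightarrow> ('a \<Rightarrow> real) \<Rightarrow> real) \<Rightarrow> ('a \<Rightarrow> real) \<Rightarrow> real" where
  "form_energy M E u = E u u + (\<integral>x. (u x)\<^sup>2 \<partial>M)"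

text \<open>Closedness: the domain is complete for the form norm \<open>(E(u,u) + \<parallel>u\<parallel>\<^sub>2\<^sup>2)\<^sup>1\<^sup>/\<^sup>2\<close>.\<close>

definition closed_form ::
  "'a measure \<Rightarrow> (('a \<Rightarrow> real) \<Rightarrow> ('a \<Rightarrow> real) \<Rightarrow> real) \<Rightarrow> ('a \<Rightarrow> real) set \<Rightarrow> bool" where
  "closed_form M E F \<longleftrightarrow>
     (\<forall>u :: nat \<Rightarrow> 'a \<Rightarrow> real.
        (\<forall>n. u n \<in> F) \<and>
        (\<forall>\<epsilon>>0. \<exists>N. \<forall>m\<ge>N. \<forall>n\<ge>N. form_energy M E (\<lambda>x. u m x - u n x) < \<epsilon>) \<longrightarrow>
        (\<exists>v\<in>F. (\<lambda>n. form_energy M E (\<lambda>x. u n x - v x)) \<longlonglongrightarrow> 0))"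

definition Markovian_form ::
  "'a measure \<Rightarrow> (('a \<Rightarrow> real) \<Rightarrow> ('a \<Rightarrow> real) \<Rightarrow> real) \<Rightarrow> ('a \<Rightarrow> real) set \<Rightarrow> bool" where
  "Markovian_form M E F \<longleftrightarrow>
     (\<forall>u\<in>F. \<forall>v\<in>borel_measurable M.
        (AE (x, y) in M \<Otimes>\<^sub>M M. \<bar>v x - v y\<bar> \<le> \<bar>u x - u y\<bar>) \<and>
        (AE x in M. \<bar>v x\<bar> \<le> \<bar>u x\<bar>) \<longrightarrow>
        v \<in> F \<and> E v v \<le> E u u)"

definition Dirichlet_space ::
  "'a measure \<Rightarrow> (('a \<Rightarrow> real) \<Rightarrow> ('a \<Rightarrow> real) \<Rightarrow> real) \<Rightarrow> ('a \<Rightarrow> real) set \<Rightarrow> bool" where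
  "Dirichlet_space M E F \<longleftrightarrow>
     good_measurable_space M \<and> sigma_finite_measure M \<and>
     symmetric_form M E F \<and> densely_defined M F \<and> closed_form M E F \<and> Markovian_form M E F"

section \<open>The heat semigroup\<close>

text \<open>Linearity and contractivity imply that each \<open>P t\<close> respects equality almost everywhere.\<close>

definition Lp_contraction_semigroup ::
  "'a measure \<Rightarrow> ennreal \<Rightarrow> (real \<Rightarrow> ('a \<Rightarrow> real) \<Rightarrow> 'a \<Rightarrow> real) \<Rightarrow> bool" where
  "Lp_contraction_semigroup M p P \<longleftrightarrow>
     (\<forall>t\<ge>0. \<forall>f\<in>Lp M p. P t f \<in> Lp M p \<and> Lp_norm M p (P t f) \<le> Lp_norm M p f) \<and>
     (\<forall>t\<ge>0. \<forall>f\<in>Lp M p. \<forall>g\<in>Lp M p. \<forall>a b.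
        AE x in M. P t (\<lambda>x. a * f x + b * g x) x = a * P t f x + b * P t g x) \<and>
     (\<forall>f\<in>Lp M p. AE x in M. P 0 f x = f x) \<and>
     (\<forall>s\<ge>0. \<forall>t\<ge>0. \<forall>f\<in>Lp M p. AE x in M. P (s + t) f x = P s (P t f) x)"

definition L2_generator ::
  "'a measure \<Rightarrow> (real \<Rightarrow> ('a \<Rightarrow> real) \<Rightarrow> 'a \<Rightarrow> real) \<Rightarrow> (('a \<Rightarrow> real) \<times> ('a \<Rightarrow> real)) set" where
  "L2_generator M P =
     {(f, h). f \<in> Lp M 2 \<and> h \<in> Lp M 2 \<and>
        ((\<lambda>t. Lp_norm M 2 (\<lambda>x. (P t f x - f x) / t - h x)) \<longlongrightarrow> 0) (at_right 0)}"

definition form_generator ::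
  "'a measure \<Rightarrow> (('a \<Rightarrow> real) \<Rightarrow> ('a \<Rightarrow> real) \<Rightarrow> real) \<Rightarrow> ('a \<Rightarrow> real) set
     \<Rightarrow> (('a \<Rightarrow> real) \<times> ('a \<Rightarrow> real)) set" where
  "form_generator M E F =
     {(f, h). f \<in> F \<and> h \<in> Lp M 2 \<and> (\<forall>v\<in>F. E f v = - (\<integral>x. h x * v x \<partial>M))}"

text \<open>\<open>P\<close> is the semigroup \<open>e\<^sup>t\<^sup>L\<close> on \<open>L\<^sup>2\<close>, where \<open>L\<close> is the self-adjoint operator with
  \<open>E(f,v) = -\<langle>L f, v\<rangle>\<close>, together with its extensions to all \<open>L\<^sup>p\<close>, \<open>1 \<le> p \<le> \<infinity>\<close>. A single map
  \<open>P t\<close> acts on all these spaces, so the extensions agree on intersections. For \<open>p < \<infinity>\<close> the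
  extension is determined by density of \<open>L\<^sup>2 \<inter> L\<^sup>p\<close>; on \<open>L\<^sup>\<infinity>\<close> it is the dual of the one on \<open>L\<^sup>1\<close>,
  which is the last conjunct.\<close>

definition heat_semigroup ::
  "'a measure \<Rightarrow> (('a \<Rightarrow> real) \<Rightarrow> ('a \<Rightarrow> real) \<Rightarrow> real) \<Rightarrow> ('a \<Rightarrow> real) set
     \<Rightarrow> (real \<Rightarrow> ('a \<Rightarrow> real) \<Rightarrow> 'a \<Rightarrow> real) \<Rightarrow> bool" where
  "heat_semigroup M E F P \<longleftrightarrow>
     (\<forall>p\<ge>1. Lp_contraction_semigroup M p P) \<and>
     (\<forall>f\<in>Lp M 2. ((\<lambda>t. Lp_norm M 2 (\<lambda>x. P t f x - f x)) \<longlongrightarrow> 0) (at_right 0)) \<and>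
     (\<forall>t\<ge>0. \<forall>f\<in>Lp M 2. \<forall>g\<in>Lp M 2. (\<integral>x. P t f x * g x \<partial>M) = (\<integral>x. f x * P t g x \<partial>M)) \<and>
     (\<forall>t\<ge>0. \<forall>f\<in>Lp M 2. (AE x in M. 0 \<le> f x \<and> f x \<le> 1) \<longrightarrow>
        (AE x in M. 0 \<le> P t f x \<and> P t f x \<le> 1)) \<and>
     L2_generator M P = form_generator M E F \<and>
     (\<forall>t\<ge>0. \<forall>f\<in>Lp M \<infinity>. \<forall>g\<in>Lp M 1. (\<integral>x. P t f x * g x \<partial>M) = (\<integral>x. f x * P t g x \<partial>M))"

definition conservative ::
  "'a measure \<Rightarrow> (real \<Rightarrow> ('a \<Rightarrow> real) \<Rightarrow> 'a \<Rightarrow> real) \<Rightarrow> bool" where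
  "conservative M P \<longleftrightarrow> (\<forall>t\<ge>0. AE x in M. P t (\<lambda>_. 1) x = 1)"

definition heat_kernel ::
  "'a measure \<Rightarrow> (real \<Rightarrow> ('a \<Rightarrow> real) \<Rightarrow> 'a \<Rightarrow> real) \<Rightarrow> (real \<Rightarrow> 'a \<Rightarrow> 'a \<Rightarrow> real) \<Rightarrow> bool" where
  "heat_kernel M P k \<longleftrightarrow>
     (\<lambda>(t, x, y). k t x y) \<in> borel_measurable (restrict_space borel {0<..} \<Otimes>\<^sub>M M \<Otimes>\<^sub>M M) \<and>
     (\<forall>t>0. \<forall>x\<in>space M. \<forall>y\<in>space M. 0 \<le> k t x y) \<and>
     (\<forall>t>0. \<forall>p\<ge>1. \<forall>f\<in>Lp M p. AE x in M.
        integrable M (\<lambda>y. k t x y * f y) \<and> P t f x = (\<integral>y. k t x y * f y \<partial>M))"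

section \<open>The Besov seminorm\<close>

definition Besov_functional ::
  "'a measure \<Rightarrow> (real \<Rightarrow> 'a \<Rightarrow> 'a \<Rightarrow> real) \<Rightarrow> real \<Rightarrow> real \<Rightarrow> ('a \<Rightarrow> real) \<Rightarrow> real \<Rightarrow> ennreal" where
  "Besov_functional M k p \<alpha> f t =
     ennreal (t powr (- \<alpha>)) *
     enn_powr (\<integral>\<^sup>+y. (\<integral>\<^sup>+x. ennreal (\<bar>f x - f y\<bar> powr p * k t x y) \<partial>M) \<partial>M) (1 / p)"

definition Besov_seminorm ::
  "'a measure \<Rightarrow> (real \<Rightarrow> 'a \<Rightarrow> 'a \<Rightarrow> real) \<Rightarrow> real \<Rightarrow> real \<Rightarrow> ('a \<Rightarrow> real) \<Rightarrow> ennreal" where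
  "Besov_seminorm M k p \<alpha> f = (SUP t\<in>{0<..}. Besov_functional M k p \<alpha> f t)"

end

theory Submission
  imports Defs
begin

text \<open>
  Cut \<open>\<bar>f\<bar>\<close> into its dyadic layers \<open>f\<^sub>j = min \<bar>f\<bar> 2\<^sup>j\<^sup>+\<^sup>1 - min \<bar>f\<bar> 2\<^sup>j\<close> and let \<open>m\<^sub>j\<close> be the measure of
  \<open>{\<bar>f\<bar> \<ge> 2\<^sup>j}\<close>. Conservativeness and the heat kernel bound, used at the time \<open>t\<close> with
  \<open>t\<^sup>\<beta>\<close> a fixed multiple of \<open>m\<^sub>j\<close>, give a weak-type estimate which for \<open>a\<^sub>j = 2\<^sup>j\<^sup>q m\<^sub>j\<close> and
  \<open>\<theta> = p \<alpha> / \<beta> < 1\<close> reads \<open>a\<^sub>j\<^sub>+\<^sub>1 \<le> c N\<^sub>j a\<^sub>j\<^sup>\<theta>\<close>, where \<open>N\<^sub>j\<close> is the \<open>p\<close>-th power of the Besov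
  seminorm of \<open>f\<^sub>j\<close>. The increments of the layers add up to at most the increment of \<open>f\<close>, so at
  each time the energies of the \<open>f\<^sub>j\<close> add up to at most that of \<open>f\<close>; since by hypothesis (2) the
  seminorms are controlled by their values at one common small time, the sum of the \<open>N\<^sub>j\<close> is bounded by
  a multiple of the \<open>p\<close>-th power of the seminorm of \<open>f\<close>. The recursion then bounds first \<open>sup a\<^sub>j\<close>, which is finite
  on \<open>j \<le> K\<close> because \<open>f\<close> is in \<open>L\<^sup>p\<close>, and then the sum of the \<open>a\<^sub>j\<close>, which dominates the
  integral of \<open>\<bar>f\<bar>\<^sup>q\<close>.
\<close>

section \<open>Elementary inequalities for real powers\<close>

lemma powr_superadditive:
  fixes a b p :: real
  assumes "0 \<le> a" "0 \<le> b" "1 \<le> p"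
  shows "a powr p + b powr p \<le> (a + b) powr p"
proof -
  have split: "c powr p = c * c powr (p - 1)" if "0 \<le> c" for c :: real
    using that powr_mult_base[of c "p - 1"] by simp
  have "a * a powr (p - 1) + b * b powr (p - 1)
      \<le> a * (a + b) powr (p - 1) + b * (a + b) powr (p - 1)"
    using assms by (intro add_mono mult_left_mono powr_mono2) auto
  also have "\<dots> = (a + b) powr p"
    using assms split[of "a + b"] by (simp add: algebra_simps)
  finally show ?thesis
    using assms split by simp
qed

text \<open>Turns a bound on the sum of the layer increments into a bound on the sum of their
  \<open>p\<close>-th powers, hence of their energies.\<close>

lemma sum_powr_le_powr_sum:
  fixes w :: "'i \<Rightarrow> real"
  assumes "finite J" "\<And>i. i \<in> J \<Longrightarrow> 0 \<le> w i" "1 \<le> p"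
  shows "(\<Sum>i\<in>J. w i powr p) \<le> (\<Sum>i\<in>J. w i) powr p"
  using assms(1,2)
proof (induction J rule: finite_induct)
  case (insert i J)
  have "w i powr p + (\<Sum>i\<in>J. w i powr p) \<le> w i powr p + (\<Sum>i\<in>J. w i) powr p"
    using insert by simp
  also have "\<dots> \<le> (w i + (\<Sum>i\<in>J. w i)) powr p"
    using insert assms(3) by (intro powr_superadditive) (auto intro: sum_nonneg)
  finally show ?case
    using insert by simp
qed simp

lemma add_powr_le:
  fixes a b p :: real
  assumes "0 \<le> a" "0 \<le> b" "0 \<le> p"
  shows "(a + b) powr p \<le> 2 powr p * (a powr p + b powr p)"
proof -
  have "(a + b) powr p \<le> (2 * max a b) powr p"
    using assms by (intro powr_mono2) auto
  also have "\<dots> = 2 powr p * max a b powr p"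
    using assms by (simp add: powr_mult)
  also have "\<dots> \<le> 2 powr p * (a powr p + b powr p)"
    by (intro mult_left_mono) (auto simp: max_def)
  finally show ?thesis .
qed

section \<open>Dyadic layers\<close>

text \<open>The slice of \<open>u\<close> between the heights 2^k and 2^(k+1), that is, u - 2^k
  clipped to the range from 0 to 2^k. Written as a difference of truncations, it telescopes over
  \<open>k\<close>.\<close>

definition dyadic_layer :: "int \<Rightarrow> real \<Rightarrow> real" where
  "dyadic_layer k u = min u (2 powr (k + 1)) - min u (2 powr k)"

lemma two_powr_Suc: "(2::real) powr of_int (k + 1) = 2 * 2 powr of_int k"
  by (simp add: powr_add)

lemma dyadic_layer_alt: "dyadic_layer k u = min u (2 * 2 powr k) - min u (2 powr k)"
  using two_powr_Suc[of k] by (simp add: dyadic_layer_def)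

lemma dyadic_layer_nonneg: "0 \<le> dyadic_layer k u"
  and dyadic_layer_le: "dyadic_layer k u \<le> 2 powr k"
  and dyadic_layer_le_self: "0 \<le> u \<Longrightarrow> dyadic_layer k u \<le> u"
  and dyadic_layer_eq_0: "u \<le> 2 powr k \<Longrightarrow> dyadic_layer k u = 0"
  and dyadic_layer_mono: "v \<le> u \<Longrightarrow> dyadic_layer k v \<le> dyadic_layer k u"
  unfolding dyadic_layer_alt
  using powr_gt_zero[of 2 "real_of_int k", THEN iffD2, OF zero_neq_numeral[symmetric]] by linarith+

lemma dyadic_layer_top: "2 powr (k + 1) \<le> u \<Longrightarrow> dyadic_layer k u = 2 powr k"
  using powr_gt_zero[of 2 "real_of_int k", THEN iffD2, OF zero_neq_numeral[symmetric]]
    two_powr_Suc[of k]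
  unfolding dyadic_layer_alt by linarith

lemma dyadic_layer_measurable [measurable]: "dyadic_layer k \<in> borel_measurable borel"
  unfolding dyadic_layer_def[abs_def] by measurable

lemma sum_dyadic_layer:
  "(\<Sum>i<n. dyadic_layer (a + int i) u) = min u (2 powr (a + int n)) - min u (2 powr a)"
  by (induction n) (auto simp: dyadic_layer_def algebra_simps)

text \<open>Layers are monotone, so for \<open>v \<le> u\<close> the absolute values drop. Over
  consecutive indices the sum then telescopes to the increment of a truncation, which is at most
  \<open>u - v\<close>.\<close>

lemma sum_dyadic_layer_diff_le:
  assumes "finite J"
  shows "(\<Sum>k\<in>J. \<bar>dyadic_layer k u - dyadic_layer k v\<bar>) \<le> \<bar>u - v\<bar>"
proof -
  have *: "(\<Sum>k\<in>J. \<bar>dyadic_layer k u - dyadic_layer k v\<bar>) \<le> u - v" if "v \<le> u" for u v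
  proof -
    \<comment> \<open>Telescoping needs consecutive indices; inserting 0 covers the empty
      \<open>J\<close>.\<close>
    obtain a b where J: "J \<subseteq> {a..<b}"
    proof
      show "J \<subseteq> {Min (insert 0 J)..<Max (insert 0 J) + 1}"
      proof
        fix k assume "k \<in> J"
        then have "Min (insert 0 J) \<le> k" "k \<le> Max (insert 0 J)"
          using assms by (auto intro: Min_le Max_ge)
        then show "k \<in> {Min (insert 0 J)..<Max (insert 0 J) + 1}" by simp
      qed
    qed
    have "{a..<b} = (\<lambda>i. a + int i) ` {..<nat (b - a)}"
    proof (intro equalityI subsetI)
      fix k assume "k \<in> {a..<b}"
      then show "k \<in> (\<lambda>i. a + int i) ` {..<nat (b - a)}"
        by (intro image_eqI[of _ _ "nat (k - a)"]) auto
    qed auto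
    then have reindex: "(\<Sum>k\<in>{a..<b}. h k) = (\<Sum>i<nat (b - a). h (a + int i))"
      for h :: "int \<Rightarrow> real"
      by (simp add: sum.reindex inj_on_def)
    have "(\<Sum>k\<in>J. \<bar>dyadic_layer k u - dyadic_layer k v\<bar>)
        \<le> (\<Sum>k\<in>{a..<b}. \<bar>dyadic_layer k u - dyadic_layer k v\<bar>)"
      using J by (intro sum_mono2) auto
    also have "\<dots> = (\<Sum>k\<in>{a..<b}. dyadic_layer k u) - (\<Sum>k\<in>{a..<b}. dyadic_layer k v)"
      using dyadic_layer_mono[OF that] by (simp add: sum_subtractf)
    \<comment> \<open>Here \<open>a + int (nat (b - a))\<close> is \<open>max a b\<close>, so the
      upper truncation height is never below the lower one.\<close>
    also have "\<dots> \<le> u - v"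
      using that powr_mono[of "real_of_int a" "a + int (nat (b - a))" 2]
      unfolding reindex sum_dyadic_layer by (auto simp: min_def)
    finally show ?thesis .
  qed
  show ?thesis
  proof (cases "v \<le> u")
    case True
    then show ?thesis using *[of v u] by simp
  next
    case False
    then show ?thesis using *[of u v] by (simp add: abs_minus_commute)
  qed
qed

lemma dyadic_layer_Lipschitz: "\<bar>dyadic_layer k u - dyadic_layer k v\<bar> \<le> \<bar>u - v\<bar>"
  using sum_dyadic_layer_diff_le[of "{k}"] by simp

lemma ex_dyadic:
  fixes u :: real
  assumes "0 < u"
  obtains k :: int where "2 powr k \<le> u" "u \<le> 2 powr (k + 1)"
proof
  show "2 powr \<lfloor>log 2 u\<rfloor> \<le> u" "u \<le> 2 powr (\<lfloor>log 2 u\<rfloor> + 1)"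
    using assms le_log_iff[of 2 u "\<lfloor>log 2 u\<rfloor>"] log_le_iff[of 2 u "\<lfloor>log 2 u\<rfloor> + 1"]
    by linarith+
qed

section \<open>The summation argument\<close>

text \<open>The bound is a fixed point of x \<mapsto> c Z x^\<theta>. Since \<theta> < 1, a finite
  supremum obeying the recursion cannot exceed it. One further use of the recursion replaces
  \<open>a\<close> by the summable \<open>N\<close>.\<close>

lemma dyadic_iteration:
  fixes a N :: "int \<Rightarrow> real" and c Z \<theta> :: real
  assumes a: "\<And>k. 0 \<le> a k" and N: "\<And>k. 0 \<le> N k" and c: "0 \<le> c"
    and \<theta>: "0 < \<theta>" "\<theta> < 1"
    and rec: "\<And>k. a (k + 1) \<le> c * N k * a k powr \<theta>"
    and bdd: "\<And>K. bdd_above (a ` {..K})"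
    and sum: "\<And>J. finite J \<Longrightarrow> (\<Sum>k\<in>J. N k) \<le> Z"
    and J: "finite J"
  shows "(\<Sum>k\<in>J. a k) \<le> (c * Z) powr (1 / (1 - \<theta>))"
proof -
  define H where "H = (c * Z) powr (1 / (1 - \<theta>))"
  have NZ: "N k \<le> Z" for k using sum[of "{k}"] by simp
  have Z: "0 \<le> Z" using sum[of "{}"] by simp
  have H: "c * Z * H powr \<theta> = H"
  proof (cases "c * Z = 0")
    case False
    then have "0 < c * Z" using c Z by (simp add: less_le)
    moreover have "1 + 1 / (1 - \<theta>) * \<theta> = 1 / (1 - \<theta>)" using \<theta> by (simp add: field_simps)
    ultimately have "(c * Z) powr 1 * (c * Z) powr (1 / (1 - \<theta>) * \<theta>) = H"
      unfolding H_def powr_add[symmetric] by simp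
    then show ?thesis
      using \<open>0 < c * Z\<close> by (simp add: H_def powr_powr)
  next
    case True
    show ?thesis unfolding H_def True by simp
  qed
  have le_H: "a K \<le> H" for K
  proof -
    \<comment> \<open>The recursion looks one index back and so stays inside \<open>{..K}\<close>.
      By \<open>bdd\<close> the supremum is a genuine one, and \<open>S powr \<theta>\<close> can be
      divided out.\<close>
    define S where "S = (SUP k\<in>{..K}. a k)"
    have S: "a k \<le> S" if "k \<le> K" for k
      unfolding S_def using that by (intro cSUP_upper bdd) auto
    have S0: "0 \<le> S" using S[of K] a[of K] by simp
    have "a k \<le> c * Z * S powr \<theta>" if "k \<le> K" for k
    proof -
      have "a k \<le> c * N (k - 1) * a (k - 1) powr \<theta>" using rec[of "k - 1"] by simp
      also have "\<dots> \<le> c * Z * S powr \<theta>"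
        using that a N c Z NZ \<theta> S[of "k - 1"] by (intro mult_mono powr_mono2) auto
      finally show ?thesis .
    qed
    then have S_le: "S \<le> c * Z * S powr \<theta>"
      unfolding S_def[symmetric] by (subst S_def, intro cSUP_least) auto
    have "S \<le> H"
    proof (cases "S = 0")
      case False
      with S0 have pos: "0 < S" by simp
      have "S powr (1 - \<theta>) \<le> c * Z"
        using S_le pos by (simp add: powr_diff field_simps)
      then have "(S powr (1 - \<theta>)) powr (1 / (1 - \<theta>)) \<le> H"
        unfolding H_def using \<theta> by (intro powr_mono2) auto
      then show ?thesis using pos \<theta> by (simp add: powr_powr)
    qed (simp add: H_def)
    then show ?thesis using S[of K] by simp
  qed
  \<comment> \<open>The uniform bound enters the recursion once more; the shifted index set is again
    finite, so \<open>sum\<close> applies to it.\<close>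
  have "(\<Sum>k\<in>J. a k) \<le> (\<Sum>k\<in>J. c * H powr \<theta> * N (k - 1))"
  proof (rule sum_mono)
    fix k
    have "a k \<le> c * N (k - 1) * a (k - 1) powr \<theta>" using rec[of "k - 1"] by simp
    also have "\<dots> \<le> c * N (k - 1) * H powr \<theta>"
      using a N c \<theta> le_H by (intro mult_left_mono powr_mono2) auto
    finally show "a k \<le> c * H powr \<theta> * N (k - 1)" by (simp add: mult_ac)
  qed
  also have "\<dots> = c * H powr \<theta> * (\<Sum>k\<in>(\<lambda>k. k - 1) ` J. N k)"
    by (simp add: sum_distrib_left sum.reindex inj_on_def)
  also have "\<dots> \<le> c * H powr \<theta> * Z"
    using J c by (intro mult_left_mono sum) auto
  also have "\<dots> = H" using H by (simp add: mult_ac)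
  finally show ?thesis unfolding H_def .
qed

section \<open>Jump energies\<close>

text \<open>The double integral of \<open>Besov_functional\<close> at a fixed time, with
  \<open>K\<close> for \<open>k t\<close> and the same order of integration.\<close>

definition jump_energy :: "'a measure \<Rightarrow> ('a \<Rightarrow> 'a \<Rightarrow> real) \<Rightarrow> real \<Rightarrow> ('a \<Rightarrow> real) \<Rightarrow> ennreal" where
  "jump_energy M K p f = (\<integral>\<^sup>+y. (\<integral>\<^sup>+x. ennreal (\<bar>f x - f y\<bar> powr p * K x y) \<partial>M) \<partial>M)"

lemma enn_powr_le_iff:
  assumes "0 < r" "0 \<le> b"
  shows "enn_powr x r \<le> ennreal b \<longleftrightarrow> x \<le> ennreal (b powr (1 / r))"
proof (cases x)
  case (real z)
  have "z powr r \<le> b \<longleftrightarrow> z \<le> b powr (1 / r)"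
  proof
    assume "z powr r \<le> b"
    then have "(z powr r) powr (1 / r) \<le> b powr (1 / r)"
      using assms by (intro powr_mono2) auto
    then show "z \<le> b powr (1 / r)" using assms real by (simp add: powr_powr)
  next
    assume "z \<le> b powr (1 / r)"
    then have "z powr r \<le> (b powr (1 / r)) powr r"
      using assms real by (intro powr_mono2) auto
    then show "z powr r \<le> b" using assms by (simp add: powr_powr)
  qed
  then show ?thesis using assms real by (simp add: enn_powr_def)
qed (simp add: enn_powr_def top_unique)

text \<open>Removes the root and the power of \<open>t\<close>, so that estimates can be made on
  energies, which can be summed over the layers.\<close>

lemma Besov_functional_le_iff:
  assumes "0 < t" "0 < p" "0 \<le> b"
  shows "Besov_functional M k p \<alpha> f t \<le> ennreal b
    \<longleftrightarrow> jump_energy M (k t) p f \<le> ennreal (t powr (\<alpha> * p) * b powr p)"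
proof -
  let ?x = "enn_powr (jump_energy M (k t) p f) (1 / p)"
  have inv: "ennreal (t powr \<alpha>) * ennreal (t powr (- \<alpha>)) = 1"
    using assms by (simp add: ennreal_mult'[symmetric] powr_minus)
  have "ennreal (t powr (- \<alpha>)) * ?x \<le> ennreal b \<longleftrightarrow> ?x \<le> ennreal (t powr \<alpha>) * ennreal b"
  proof
    assume "ennreal (t powr (- \<alpha>)) * ?x \<le> ennreal b"
    then have "ennreal (t powr \<alpha>) * (ennreal (t powr (- \<alpha>)) * ?x) \<le> ennreal (t powr \<alpha>) * ennreal b"
      by (rule mult_left_mono) simp
    then show "?x \<le> ennreal (t powr \<alpha>) * ennreal b"
      by (simp add: mult.assoc[symmetric] inv)
  next
    assume "?x \<le> ennreal (t powr \<alpha>) * ennreal b"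
    then have "ennreal (t powr (- \<alpha>)) * ?x \<le> ennreal (t powr (- \<alpha>)) * (ennreal (t powr \<alpha>) * ennreal b)"
      by (rule mult_left_mono) simp
    then show "ennreal (t powr (- \<alpha>)) * ?x \<le> ennreal b"
      unfolding mult.assoc[symmetric] using inv by (simp add: mult.commute[of "ennreal (t powr (- \<alpha>))"])
  qed
  also have "\<dots> \<longleftrightarrow> jump_energy M (k t) p f \<le> ennreal ((t powr \<alpha> * b) powr p)"
    using assms enn_powr_le_iff[of "1 / p" "t powr \<alpha> * b"] by (simp add: ennreal_mult')
  also have "(t powr \<alpha> * b) powr p = t powr (\<alpha> * p) * b powr p"
    using assms by (simp add: powr_mult powr_powr)
  finally show ?thesis
    unfolding Besov_functional_def jump_energy_def .
qed

lemma jump_energy_mono: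
  assumes "0 \<le> p" "\<And>x y. x \<in> space M \<Longrightarrow> y \<in> space M \<Longrightarrow> 0 \<le> K x y"
    and "\<And>x y. \<bar>g x - g y\<bar> \<le> \<bar>f x - f y\<bar>"
  shows "jump_energy M K p g \<le> jump_energy M K p f"
  unfolding jump_energy_def using assms
  by (intro nn_integral_mono ennreal_leI mult_right_mono powr_mono2) auto

text \<open>The inequality holds already for the integrands: superadditivity of the
  \<open>p\<close>-th power reduces it to the bound on the sum of the layer increments, and passing
  to absolute values does not enlarge increments.\<close>

lemma sum_jump_energy_layers_le:
  assumes [measurable]: "f \<in> borel_measurable M" "case_prod K \<in> borel_measurable (M \<Otimes>\<^sub>M M)"
    and M: "sigma_finite_measure M"
    and K: "\<And>x y. x \<in> space M \<Longrightarrow> y \<in> space M \<Longrightarrow> 0 \<le> K x y"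
    and p: "1 \<le> p" and J: "finite J"
  shows "(\<Sum>j\<in>J. jump_energy M K p (\<lambda>x. dyadic_layer j \<bar>f x\<bar>)) \<le> jump_energy M K p f"
proof -
  interpret sigma_finite_measure M by fact
  let ?w = "\<lambda>j x y. \<bar>dyadic_layer j (\<bar>f x\<bar>) - dyadic_layer j (\<bar>f y\<bar>)\<bar>"
  \<comment> \<open>The inner integral runs over the first argument of \<open>K\<close>, so
    measurability is needed with the arguments swapped.\<close>
  have K': "(\<lambda>(y, x). K x y) \<in> borel_measurable (M \<Otimes>\<^sub>M M)"
    using measurable_pair_swap[OF assms(2)] by (simp add: split_def)
  have [measurable]: "(\<lambda>x. K x y) \<in> borel_measurable M" if "y \<in> space M" for y
    using that by measurable
  have m: "(\<lambda>(y, x). ennreal (?w j x y powr p * K x y)) \<in> borel_measurable (M \<Otimes>\<^sub>M M)" for j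
    using K' by (simp add: split_def)
  have [measurable]: "(\<lambda>y. \<integral>\<^sup>+x. ennreal (?w j x y powr p * K x y) \<partial>M) \<in> borel_measurable M" for j
    using m by (rule borel_measurable_nn_integral)
  have "(\<Sum>j\<in>J. jump_energy M K p (\<lambda>x. dyadic_layer j \<bar>f x\<bar>))
      = (\<integral>\<^sup>+y. (\<Sum>j\<in>J. \<integral>\<^sup>+x. ennreal (?w j x y powr p * K x y) \<partial>M) \<partial>M)"
    unfolding jump_energy_def by (rule nn_integral_sum[symmetric]) measurable
  also have "\<dots> = (\<integral>\<^sup>+y. (\<integral>\<^sup>+x. (\<Sum>j\<in>J. ennreal (?w j x y powr p * K x y)) \<partial>M) \<partial>M)"
    by (intro nn_integral_cong nn_integral_sum[symmetric]) simp
  also have "\<dots> \<le> jump_energy M K p f"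
    unfolding jump_energy_def
  proof (intro nn_integral_mono)
    fix x y assume xy: "x \<in> space M" "y \<in> space M"
    have "(\<Sum>j\<in>J. ?w j x y powr p) \<le> (\<Sum>j\<in>J. ?w j x y) powr p"
      using J p by (intro sum_powr_le_powr_sum) auto
    also have "\<dots> \<le> \<bar>\<bar>f x\<bar> - \<bar>f y\<bar>\<bar> powr p"
      using J p by (intro powr_mono2 sum_dyadic_layer_diff_le) (auto intro: sum_nonneg)
    also have "\<dots> \<le> \<bar>f x - f y\<bar> powr p"
      using p by (intro powr_mono2) auto
    finally have "(\<Sum>j\<in>J. ?w j x y powr p * K x y) \<le> \<bar>f x - f y\<bar> powr p * K x y"
      using K[OF xy] by (simp add: sum_distrib_right[symmetric] mult_right_mono)
    then show "(\<Sum>j\<in>J. ennreal (?w j x y powr p * K x y)) \<le> ennreal (\<bar>f x - f y\<bar> powr p * K x y)"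
      using K[OF xy] by (subst sum_ennreal) (auto intro: ennreal_leI)
  qed
  finally show ?thesis .
qed

text \<open>Integrating \<open>\<bar>g x\<bar>\<^sup>p \<le> 2\<^sup>p (\<bar>g x - g y\<bar>\<^sup>p + \<bar>g y\<bar>\<^sup>p)\<close> against \<open>K x y\<close> in \<open>y\<close>, the
  second summand is absorbed at the points where \<open>\<bar>g x\<bar> \<ge> s\<close>.\<close>

lemma weak_type_estimate:
  assumes [measurable]: "g \<in> borel_measurable M" "case_prod K \<in> borel_measurable (M \<Otimes>\<^sub>M M)"
    and M: "sigma_finite_measure M"
    and K: "\<And>x y. x \<in> space M \<Longrightarrow> y \<in> space M \<Longrightarrow> 0 \<le> K x y"
    and one: "AE x in M. (\<integral>\<^sup>+y. ennreal (K x y) \<partial>M) = 1"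
    and bound: "AE (x, y) in M \<Otimes>\<^sub>M M. K x y \<le> D"
    and B: "(\<integral>\<^sup>+x. ennreal (\<bar>g x\<bar> powr p) \<partial>M) \<le> ennreal B"
    and small: "2 powr p * (D * B) \<le> s powr p / 2"
    and p: "0 \<le> p" and s: "0 \<le> s" and D: "0 \<le> D" and B0: "0 \<le> B"
  shows "ennreal (s powr p) * emeasure M {x \<in> space M. s \<le> \<bar>g x\<bar>}
    \<le> ennreal (2 powr (p + 1)) * jump_energy M K p g"
proof -
  interpret M: sigma_finite_measure M by fact
  interpret pair_sigma_finite M M by unfold_locales
  define I where "I x = (\<integral>\<^sup>+y. ennreal (\<bar>g x - g y\<bar> powr p * K x y) \<partial>M)" for x
  have [measurable]: "(\<lambda>y. K x y) \<in> borel_measurable M" if "x \<in> space M" for x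
    using that by measurable
  have m: "(\<lambda>(x, y). ennreal (\<bar>g x - g y\<bar> powr p * K x y)) \<in> borel_measurable (M \<Otimes>\<^sub>M M)"
    by simp
  have [measurable]: "I \<in> borel_measurable M"
    unfolding I_def[abs_def] using m by (rule M.borel_measurable_nn_integral)
  \<comment> \<open>\<open>I\<close> integrates the second variable first,
    \<open>jump_energy\<close> the first; Tonelli's theorem reconciles them.\<close>
  have I: "(\<integral>\<^sup>+x. I x \<partial>M) = jump_energy M K p g"
    unfolding I_def jump_energy_def using Fubini[OF m] by simp
  have "AE x in M. AE y in M. K x y \<le> D"
    using AE_pair[OF bound] by simp
  then have "AE x in M. s \<le> \<bar>g x\<bar> \<longrightarrow> ennreal (s powr p) \<le> ennreal (2 powr (p + 1)) * I x"
    using one AE_space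
  proof eventually_elim
    case (elim x)
    show ?case
    proof
      assume sg: "s \<le> \<bar>g x\<bar>"
      \<comment> \<open>The term to be absorbed is at most the kernel bound times the
        \<open>p\<close>-th moment of \<open>g\<close>.\<close>
      have "(\<integral>\<^sup>+y. ennreal (\<bar>g y\<bar> powr p * K x y) \<partial>M) \<le> (\<integral>\<^sup>+y. ennreal D * ennreal (\<bar>g y\<bar> powr p) \<partial>M)"
        using elim(1) D by (intro nn_integral_mono_AE)
          (auto elim!: eventually_mono simp: ennreal_mult'[symmetric] mult.commute intro!: ennreal_leI mult_right_mono)
      also have "\<dots> = ennreal D * (\<integral>\<^sup>+y. ennreal (\<bar>g y\<bar> powr p) \<partial>M)"
        by (rule nn_integral_cmult) simp
      also have "\<dots> \<le> ennreal D * ennreal B"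
        using B by (rule mult_left_mono) simp
      finally have 1: "(\<integral>\<^sup>+y. ennreal (\<bar>g y\<bar> powr p * K x y) \<partial>M) \<le> ennreal (D * B)"
        using D by (simp add: ennreal_mult')
      \<comment> \<open>The unit mass of the kernel writes the threshold as an integral in
        \<open>y\<close>.\<close>
      have "ennreal (s powr p) = (\<integral>\<^sup>+y. ennreal (s powr p) * ennreal (K x y) \<partial>M)"
        using elim by (subst nn_integral_cmult) auto
      also have "\<dots> \<le> (\<integral>\<^sup>+y. ennreal (2 powr p) * (ennreal (\<bar>g x - g y\<bar> powr p * K x y)
          + ennreal (\<bar>g y\<bar> powr p * K x y)) \<partial>M)"
      proof (intro nn_integral_mono)
        fix y assume y: "y \<in> space M"
        have "s powr p \<le> (\<bar>g x - g y\<bar> + \<bar>g y\<bar>) powr p"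
          using s sg p by (intro powr_mono2) auto
        also have "\<dots> \<le> 2 powr p * (\<bar>g x - g y\<bar> powr p + \<bar>g y\<bar> powr p)"
          using p by (intro add_powr_le) auto
        finally have "s powr p * K x y \<le> 2 powr p * (\<bar>g x - g y\<bar> powr p + \<bar>g y\<bar> powr p) * K x y"
          using K elim y by (intro mult_right_mono) auto
        then show "ennreal (s powr p) * ennreal (K x y) \<le> ennreal (2 powr p) *
            (ennreal (\<bar>g x - g y\<bar> powr p * K x y) + ennreal (\<bar>g y\<bar> powr p * K x y))"
          using K[OF elim(3) y]
          by (simp add: ennreal_mult'[symmetric] ennreal_plus[symmetric] algebra_simps ennreal_leI del: ennreal_plus)
      qed
      also have "\<dots> = ennreal (2 powr p) * (I x + (\<integral>\<^sup>+y. ennreal (\<bar>g y\<bar> powr p * K x y) \<partial>M))"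
        unfolding I_def using elim by (simp add: nn_integral_cmult nn_integral_add)
      also have "\<dots> \<le> ennreal (2 powr p) * (I x + ennreal (D * B))"
        using 1 by (intro mult_left_mono add_left_mono) auto
      finally have *: "ennreal (s powr p) \<le> ennreal (2 powr p) * (I x + ennreal (D * B))" .
      \<comment> \<open>An infinite \<open>I x\<close> is trivial. Otherwise \<open>small\<close>
        makes the second summand at most half of the left side; absorbing it doubles the
        constant.\<close>
      show "ennreal (s powr p) \<le> ennreal (2 powr (p + 1)) * I x"
      proof (cases "I x")
        case (real z)
        have "ennreal (s powr p) \<le> ennreal (2 powr p * (z + D * B))"
          using * real D B0 by (simp add: ennreal_mult')
        then have "s powr p \<le> 2 powr p * (z + D * B)"
          using real D B0 by (subst (asm) ennreal_le_iff) auto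
        moreover have "2 powr p * (D * B) \<le> s powr p / 2"
          by (rule small)
        ultimately have "s powr p \<le> 2 powr (p + 1) * z"
          by (simp add: powr_add algebra_simps)
        then show ?thesis using real by (simp add: ennreal_mult'[symmetric] ennreal_leI)
      qed (simp add: ennreal_mult_top)
    qed
  qed
  \<comment> \<open>Chebyshev's argument: integrate the pointwise bound over the level set.\<close>
  then have "(\<integral>\<^sup>+x. ennreal (s powr p) * indicator {x \<in> space M. s \<le> \<bar>g x\<bar>} x \<partial>M)
      \<le> (\<integral>\<^sup>+x. ennreal (2 powr (p + 1)) * I x \<partial>M)"
    by (intro nn_integral_mono_AE) (auto elim!: eventually_mono simp: indicator_def)
  then show ?thesis
    by (simp add: nn_integral_cmult I nn_integral_cmult_indicator)
qed


section \<open>The Sobolev inequality\<close>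

lemma Lp_iff:
  assumes "0 < p"
  shows "f \<in> Lp M (ennreal p)
    \<longleftrightarrow> f \<in> borel_measurable M \<and> (\<integral>\<^sup>+x. ennreal (\<bar>f x\<bar> powr p) \<partial>M) < \<infinity>"
  using assms by (auto simp: Lp_def Lp_norm_def enn_powr_def less_top)

lemma Lp_dominated:
  assumes "0 < p" "f \<in> Lp M (ennreal p)" "g \<in> borel_measurable M" "\<And>x. \<bar>g x\<bar> \<le> \<bar>f x\<bar>"
  shows "g \<in> Lp M (ennreal p)"
proof -
  have "(\<integral>\<^sup>+x. ennreal (\<bar>g x\<bar> powr p) \<partial>M) \<le> (\<integral>\<^sup>+x. ennreal (\<bar>f x\<bar> powr p) \<partial>M)"
    using assms by (intro nn_integral_mono ennreal_leI powr_mono2) auto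
  with assms show ?thesis by (auto simp: Lp_iff elim: le_less_trans)
qed

text \<open>Admits the constant 1 to the kernel representation; when the measure is infinite, it
  lies in no other Lebesgue space.\<close>

lemma const_in_Linfinity: "(\<lambda>_. c) \<in> Lp M \<infinity>"
proof -
  have "esssup M (\<lambda>_. ennreal \<bar>c\<bar>) \<le> ennreal \<bar>c\<bar>"
    by (rule esssup_I) auto
  then show ?thesis
    by (auto simp: Lp_def Lp_norm_def elim: le_less_trans)
qed

lemma heat_kernel_measurable:
  assumes "heat_kernel M P k" "0 < t"
  shows "case_prod (k t) \<in> borel_measurable (M \<Otimes>\<^sub>M M)"
proof -
  have "(\<lambda>(t, x, y). k t x y) \<in> borel_measurable (restrict_space borel {0<..} \<Otimes>\<^sub>M M \<Otimes>\<^sub>M M)"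
    using assms unfolding heat_kernel_def by blast
  moreover have "(\<lambda>z. (t, z)) \<in> M \<Otimes>\<^sub>M M \<rightarrow>\<^sub>M restrict_space borel {0<..} \<Otimes>\<^sub>M M \<Otimes>\<^sub>M M"
    using assms by (intro measurable_Pair1') (simp add: space_restrict_space)
  ultimately have "(\<lambda>z. (\<lambda>(t, x, y). k t x y) (t, z)) \<in> borel_measurable (M \<Otimes>\<^sub>M M)"
    by (rule measurable_compose[rotated])
  then show ?thesis by simp
qed

text \<open>Conservativeness read through the kernel representation of \<open>P t\<close> on the
  constant 1.\<close>

lemma heat_kernel_mass:
  assumes "heat_kernel M P k" "conservative M P" "0 < t"
  shows "AE x in M. (\<integral>\<^sup>+y. ennreal (k t x y) \<partial>M) = 1"
proof -
  have "AE x in M. P t (\<lambda>_. 1) x = 1"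
    using assms unfolding conservative_def by simp
  moreover have "AE x in M. integrable M (\<lambda>y. k t x y * 1) \<and> P t (\<lambda>_. 1) x = (\<integral>y. k t x y * 1 \<partial>M)"
  proof -
    have "\<forall>f\<in>Lp M \<infinity>. AE x in M. integrable M (\<lambda>y. k t x y * f y) \<and> P t f x = (\<integral>y. k t x y * f y \<partial>M)"
    proof -
      have "(1::ennreal) \<le> \<infinity>" by simp
      then show ?thesis using assms(1,3) unfolding heat_kernel_def by blast
    qed
    then show ?thesis using const_in_Linfinity by (rule bspec)
  qed
  ultimately show ?thesis
    using AE_space
  proof eventually_elim
    case (elim x)
    then have "AE y in M. 0 \<le> k t x y"
      using assms unfolding heat_kernel_def by (intro AE_I2) blast
    with elim show ?case by (simp add: nn_integral_eq_integral)
  qed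
qed

text \<open>The quantitative core, stated for the kernel without the semigroup and for a finite
  bound \<open>A\<close>. The factors of \<open>c\<close> come from the index shift, the weak-type
  estimate and the choice of time. In \<open>4 * C\<close>, one 2 is the ratio of the ends of a
  dyadic shell and \<open>2 * C\<close> comes from \<open>sum_N\<close>.\<close>

lemma Lq_norm_le_of_Besov_le:
  fixes M :: "'a measure" and k :: "real \<Rightarrow> 'a \<Rightarrow> 'a \<Rightarrow> real"
    and p q \<alpha> \<beta> \<theta> C D A c :: real
  assumes M: "sigma_finite_measure M"
    and km: "\<And>t. 0 < t \<Longrightarrow> case_prod (k t) \<in> borel_measurable (M \<Otimes>\<^sub>M M)"
    and k0: "\<And>t x y. 0 < t \<Longrightarrow> x \<in> space M \<Longrightarrow> y \<in> space M \<Longrightarrow> 0 \<le> k t x y"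
    and k1: "\<And>t. 0 < t \<Longrightarrow> AE x in M. (\<integral>\<^sup>+y. ennreal (k t x y) \<partial>M) = 1"
    and kD: "\<And>t. 0 < t \<Longrightarrow> AE (x, y) in M \<Otimes>\<^sub>M M. k t x y \<le> D * t powr (- \<beta>)"
    and D: "0 < D" and C: "0 < C" and p: "1 \<le> p" and \<beta>: "0 < \<beta>" and \<alpha>: "0 < \<alpha>"
    and Besov: "\<And>f. f \<in> Lp M (ennreal p) \<Longrightarrow>
      Besov_seminorm M k p \<alpha> f \<le> ennreal C * Liminf (at_right 0) (Besov_functional M k p \<alpha> f)"
    and \<theta>: "\<theta> = p * \<alpha> / \<beta>" "\<theta> < 1" and q: "q = p / (1 - \<theta>)"
    and c: "c = 2 powr q * 2 powr (p + 1) * (2 powr (p + 1) * D) powr \<theta>"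
    and f: "f \<in> Lp M (ennreal p)"
    and A: "Besov_seminorm M k p \<alpha> f \<le> ennreal A" "0 \<le> A"
  shows "Lp_norm M (ennreal q) f \<le> ennreal (4 * C * c powr (1 / p) * A)"
proof -
  have \<theta>0: "0 < \<theta>" using p \<alpha> \<beta> \<theta> by simp
  have q0: "0 < q" using p \<theta> q by simp
  \<comment> \<open>The exponent identity that closes the recursion for the weighted measures
    \<open>a j\<close>.\<close>
  have q\<theta>: "q - p = q * \<theta>" using q \<theta>(2) by (simp add: field_simps)
  have pq: "p \<le> q" using q\<theta> mult_pos_pos[OF q0 \<theta>0] by linarith
  have c0: "0 < c" using c D by simp
  have [measurable]: "f \<in> borel_measurable M" using f by (simp add: Lp_def)
  have fp: "(\<integral>\<^sup>+x. ennreal (\<bar>f x\<bar> powr p) \<partial>M) < \<infinity>" using f p by (simp add: Lp_iff)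

  define g where "g j x = dyadic_layer j (\<bar>f x\<bar>)" for j x
  define S where "S j = {x \<in> space M. 2 powr j \<le> \<bar>f x\<bar>}" for j :: int
  \<comment> \<open>\<open>measure\<close> and \<open>enn2real\<close> send infinite values to 0;
    \<open>S_fin\<close>, \<open>s_eq\<close> and \<open>fp\<close> rule this out.\<close>
  define m where "m j = measure M (S j)" for j
  define s where "s j = enn2real (Besov_seminorm M k p \<alpha> (g j))" for j
  define N where "N j = s j powr p" for j
  define F where "F = enn2real (\<integral>\<^sup>+x. ennreal (\<bar>f x\<bar> powr p) \<partial>M)"

  have [measurable]: "g j \<in> borel_measurable M" for j unfolding g_def by measurable
  have [measurable]: "S j \<in> sets M" for j unfolding S_def by measurable
  have abs_g: "\<bar>g j x\<bar> = g j x" for j x by (simp add: g_def dyadic_layer_nonneg)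
  have g_Lp: "g j \<in> Lp M (ennreal p)" for j
    using p f by (rule_tac Lp_dominated) (auto simp: abs_g, auto simp: g_def dyadic_layer_le_self)
  have s0: "0 \<le> s j" for j by (simp add: s_def)

  \<comment> \<open>Chebyshev's inequality, used for finiteness in \<open>S_fin\<close> and for the
    uniform bound \<open>m_F\<close>.\<close>
  have powr_S: "ennreal (2 powr (j * p)) * emeasure M (S j) \<le> (\<integral>\<^sup>+x. ennreal (\<bar>f x\<bar> powr p) \<partial>M)" for j
  proof -
    have "ennreal (2 powr (j * p)) * emeasure M (S j)
        = (\<integral>\<^sup>+x. ennreal (2 powr (j * p)) * indicator (S j) x \<partial>M)"
      by (simp add: nn_integral_cmult_indicator)
    also have "\<dots> \<le> (\<integral>\<^sup>+x. ennreal (\<bar>f x\<bar> powr p) \<partial>M)"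
    proof (rule nn_integral_mono)
      fix x
      have "(2 powr j) powr p \<le> \<bar>f x\<bar> powr p" if "x \<in> S j"
        using that p by (intro powr_mono2) (auto simp: S_def)
      then show "ennreal (2 powr (j * p)) * indicator (S j) x \<le> ennreal (\<bar>f x\<bar> powr p)"
        by (auto simp: powr_powr indicator_def intro: ennreal_leI)
    qed
    finally show ?thesis .
  qed
  have S_fin: "emeasure M (S j) = ennreal (m j)" for j
  proof -
    have "ennreal (2 powr (j * p)) * emeasure M (S j) < \<infinity>"
      using powr_S fp by (rule le_less_trans)
    then have "emeasure M (S j) \<noteq> \<infinity>"
      by (auto simp: ennreal_mult_top)
    then show ?thesis unfolding m_def by (simp add: emeasure_eq_ennreal_measure)
  qed
  have m0: "0 \<le> m j" for j by (simp add: m_def)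
  have m_F: "2 powr (j * p) * m j \<le> F" for j
  proof -
    have "(\<integral>\<^sup>+x. ennreal (\<bar>f x\<bar> powr p) \<partial>M) = ennreal F"
      using fp by (simp add: F_def)
    then have "ennreal (2 powr (j * p) * m j) \<le> ennreal F"
      using powr_S[of j] by (simp add: S_fin ennreal_mult')
    then show ?thesis by (simp add: F_def)
  qed
  have m_mono: "m (j + 1) \<le> m j" for j
  proof -
    have "S (j + 1) \<subseteq> S j"
      unfolding S_def using two_powr_Suc[of j] powr_ge_zero[of 2 "real_of_int j"]
      by (auto simp del: powr_ge_zero)
    then have "emeasure M (S (j + 1)) \<le> emeasure M (S j)" by (rule emeasure_mono) simp
    then show ?thesis using m0 by (simp add: S_fin)
  qed

  have jump_f: "jump_energy M (k t) p f \<le> ennreal (t powr (\<alpha> * p) * A powr p)" if "0 < t" for t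
  proof -
    have "Besov_functional M k p \<alpha> f t \<le> Besov_seminorm M k p \<alpha> f"
      unfolding Besov_seminorm_def using that by (intro SUP_upper) auto
    also note A(1)
    finally show ?thesis using that p A(2) by (simp add: Besov_functional_le_iff)
  qed
  \<comment> \<open>Layers are Lipschitz with constant 1, so they inherit a finite seminorm from
    \<open>f\<close>.\<close>
  have s_eq: "Besov_seminorm M k p \<alpha> (g j) = ennreal (s j)" for j
  proof -
    have "Besov_seminorm M k p \<alpha> (g j) \<le> ennreal A"
      unfolding Besov_seminorm_def
    proof (rule SUP_least)
      fix t :: real assume "t \<in> {0<..}"
      then have t: "0 < t" by simp
      have "jump_energy M (k t) p (g j) \<le> jump_energy M (k t) p f"
        using p t k0 unfolding g_def
        by (intro jump_energy_mono order_trans[OF dyadic_layer_Lipschitz abs_triangle_ineq3]) auto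
      also note jump_f[OF t]
      finally show "Besov_functional M k p \<alpha> (g j) t \<le> ennreal A"
        using p t A by (simp add: Besov_functional_le_iff)
    qed
    then have "Besov_seminorm M k p \<alpha> (g j) < \<infinity>"
      by (rule le_less_trans) simp
    then show ?thesis by (simp add: s_def)
  qed
  have jump_g: "jump_energy M (k t) p (g j) \<le> ennreal (t powr (\<alpha> * p) * N j)" if "0 < t" for t j
  proof -
    have "Besov_functional M k p \<alpha> (g j) t \<le> ennreal (s j)"
      unfolding s_eq[symmetric] Besov_seminorm_def using that by (intro SUP_upper) auto
    then show ?thesis using that p s0 by (simp add: Besov_functional_le_iff N_def)
  qed

  have rec_m: "2 powr (j * p) * m (j + 1) \<le> 2 powr (p + 1) * ((2 powr (p + 1) * D * m j) powr \<theta> * N j)" for j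
  proof (cases "m j = 0")
    case True
    then have "m (j + 1) = 0" using m_mono[of j] m0[of "j + 1"] by simp
    then show ?thesis by (simp add: N_def)
  next
    case False
    \<comment> \<open>At this time t^\<beta> = T, so the kernel is at most D / T. Since the
      \<open>p\<close>-th moment of \<open>g j\<close> is at most 2^(jp) m_j, the smallness
      condition of the weak-type estimate holds with equality.\<close>
    define T where "T = 2 powr (p + 1) * D * m j"
    define t where "t = T powr (1 / \<beta>)"
    have T: "0 < T" using False m0[of j] D by (simp add: T_def less_le)
    have t: "0 < t" using T by (simp add: t_def)
    have "(\<integral>\<^sup>+x. ennreal (\<bar>g j x\<bar> powr p) \<partial>M) \<le> (\<integral>\<^sup>+x. ennreal (2 powr (j * p)) * indicator (S j) x \<partial>M)"
    proof (rule nn_integral_mono)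
      fix x assume x: "x \<in> space M"
      have "g j x powr p \<le> (2 powr j) powr p"
        unfolding g_def using p by (intro powr_mono2 dyadic_layer_le dyadic_layer_nonneg) auto
      moreover have "g j x = 0" if "x \<notin> S j"
        using that x by (simp add: g_def S_def dyadic_layer_eq_0)
      ultimately show "ennreal (\<bar>g j x\<bar> powr p) \<le> ennreal (2 powr (j * p)) * indicator (S j) x"
        by (auto simp: abs_g powr_powr indicator_def intro: ennreal_leI)
    qed
    also have "\<dots> = ennreal (2 powr (j * p) * m j)"
      using m0 by (simp add: nn_integral_cmult_indicator S_fin ennreal_mult')
    finally have B: "(\<integral>\<^sup>+x. ennreal (\<bar>g j x\<bar> powr p) \<partial>M) \<le> ennreal (2 powr (j * p) * m j)" .
    have "t powr (- \<beta>) = 1 / T"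
      using \<beta> T by (simp add: t_def powr_powr powr_minus divide_inverse)
    then have "2 powr p * (D * t powr (- \<beta>) * (2 powr (j * p) * m j)) = (2 powr j) powr p / 2"
      using T D False by (simp add: T_def powr_powr powr_add)
    then have "ennreal ((2 powr j) powr p) * emeasure M {x \<in> space M. 2 powr j \<le> \<bar>g j x\<bar>}
        \<le> ennreal (2 powr (p + 1)) * jump_energy M (k t) p (g j)"
      using p D t m0 by (intro weak_type_estimate[OF _ km M k0 k1 kD B]) auto
    also have "\<dots> \<le> ennreal (2 powr (p + 1)) * ennreal (t powr (\<alpha> * p) * N j)"
      by (intro mult_left_mono jump_g t) simp
    finally have 1: "ennreal ((2 powr j) powr p) * emeasure M {x \<in> space M. 2 powr j \<le> \<bar>g j x\<bar>}
        \<le> ennreal (2 powr (p + 1) * (t powr (\<alpha> * p) * N j))"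
      by (simp add: ennreal_mult')
    \<comment> \<open>Layer \<open>j\<close> attains its maximum 2^j on the next level set; this
      produces the index shift.\<close>
    have "S (j + 1) \<subseteq> {x \<in> space M. 2 powr j \<le> \<bar>g j x\<bar>}"
      unfolding S_def g_def by (auto simp: dyadic_layer_top)
    then have "emeasure M (S (j + 1)) \<le> emeasure M {x \<in> space M. 2 powr j \<le> \<bar>g j x\<bar>}"
      by (rule emeasure_mono) measurable
    then have "ennreal ((2 powr j) powr p) * ennreal (m (j + 1))
        \<le> ennreal ((2 powr j) powr p) * emeasure M {x \<in> space M. 2 powr j \<le> \<bar>g j x\<bar>}"
      unfolding S_fin by (rule mult_left_mono) simp
    also note 1
    finally have "2 powr (j * p) * m (j + 1) \<le> 2 powr (p + 1) * (t powr (\<alpha> * p) * N j)"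
      using m0 by (simp add: powr_powr ennreal_mult'[symmetric] N_def)
    moreover have "t powr (\<alpha> * p) = T powr \<theta>"
      by (simp add: t_def powr_powr \<theta> mult.commute)
    ultimately show ?thesis by (simp add: T_def)
  qed

  have sum_N: "(\<Sum>j\<in>J. N j) \<le> (2 * C * A) powr p" if J: "finite J" for J
  proof -
    \<comment> \<open>The hypothesis gives a lower limit of at least s_j / C. Halving makes the
      inequality strict for s_j > 0, so it holds at all small times.\<close>
    define b where "b j = s j / (2 * C)" for j
    have b0: "0 \<le> b j" for j using s0 C by (simp add: b_def)
    have "eventually (\<lambda>t. ennreal (t powr (\<alpha> * p) * b j powr p) \<le> jump_energy M (k t) p (g j)) (at_right 0)" for j
    proof (cases "s j = 0")
      case False
      have "ennreal (b j) < Liminf (at_right 0) (Besov_functional M k p \<alpha> (g j))"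
      proof (rule ccontr)
        assume "\<not> ?thesis"
        then have "ennreal C * Liminf (at_right 0) (Besov_functional M k p \<alpha> (g j)) \<le> ennreal C * ennreal (b j)"
          by (intro mult_left_mono) auto
        with Besov[OF g_Lp, of j] have "ennreal (s j) \<le> ennreal (C * b j)"
          using C by (simp add: s_eq ennreal_mult')
        then have "s j \<le> C * b j" using b0 C by (simp add: ennreal_le_iff)
        then show False using False s0[of j] C by (simp add: b_def)
      qed
      then have "eventually (\<lambda>t. ennreal (b j) < Besov_functional M k p \<alpha> (g j) t) (at_right 0)"
        by (rule less_LiminfD)
      then show ?thesis
        using eventually_at_right_less[of 0]
      proof eventually_elim
        case (elim t)
        then have "\<not> Besov_functional M k p \<alpha> (g j) t \<le> ennreal (b j)" by simp
        then show ?case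
          using elim p b0 by (simp add: Besov_functional_le_iff)
      qed
    qed (simp add: b_def)
    \<comment> \<open>Finiteness of \<open>J\<close> yields one time that serves all layers, and
      there their energies can be added.\<close>
    then have "eventually (\<lambda>t. \<forall>j\<in>J. ennreal (t powr (\<alpha> * p) * b j powr p) \<le> jump_energy M (k t) p (g j)) (at_right 0)"
      using J by (intro eventually_ball_finite) auto
    then have "eventually (\<lambda>t. 0 < t \<and> (\<forall>j\<in>J. ennreal (t powr (\<alpha> * p) * b j powr p) \<le> jump_energy M (k t) p (g j))) (at_right 0)"
      using eventually_at_right_less[of 0] by eventually_elim simp
    then obtain t :: real where t: "0 < t"
      and tJ: "\<And>j. j \<in> J \<Longrightarrow> ennreal (t powr (\<alpha> * p) * b j powr p) \<le> jump_energy M (k t) p (g j)"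
      using eventually_happens'[OF trivial_limit_at_right_real] by blast
    have "ennreal (\<Sum>j\<in>J. t powr (\<alpha> * p) * b j powr p) = (\<Sum>j\<in>J. ennreal (t powr (\<alpha> * p) * b j powr p))"
      by (rule sum_ennreal[symmetric]) simp
    also have "\<dots> \<le> (\<Sum>j\<in>J. jump_energy M (k t) p (g j))"
      using tJ by (rule sum_mono)
    also have "\<dots> \<le> jump_energy M (k t) p f"
      unfolding g_def using t p J k0 by (intro sum_jump_energy_layers_le km M) auto
    also note jump_f[OF t]
    finally have "t powr (\<alpha> * p) * (\<Sum>j\<in>J. b j powr p) \<le> t powr (\<alpha> * p) * A powr p"
      by (simp add: sum_distrib_left)
    then have b_sum: "(\<Sum>j\<in>J. b j powr p) \<le> A powr p" using t by simp
    have "N j = (2 * C) powr p * b j powr p" for j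
      using C s0[of j] by (simp add: N_def b_def powr_mult[symmetric])
    then have "(\<Sum>j\<in>J. N j) = (2 * C) powr p * (\<Sum>j\<in>J. b j powr p)"
      by (simp add: sum_distrib_left)
    also have "\<dots> \<le> (2 * C) powr p * A powr p"
      using b_sum by (intro mult_left_mono) auto
    also have "\<dots> = (2 * C * A) powr p"
      using C A(2) by (simp add: powr_mult)
    finally show ?thesis .
  qed

  define a where "a j = 2 powr (j * q) * m j" for j :: int
  have a0: "0 \<le> a j" for j using m0 by (simp add: a_def)
  have "a (j + 1) \<le> c * N j * a j powr \<theta>" for j
  proof -
    \<comment> \<open>Split 2^(jq) into 2^(jp), consumed by \<open>rec_m\<close>, and 2^(j(q-p)) =
      2^(jq\<theta>), which completes m_j^\<theta> to a_j^\<theta>.\<close>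
    have "a (j + 1) = 2 powr q * 2 powr (j * (q - p)) * (2 powr (j * p) * m (j + 1))"
      by (simp add: a_def powr_add[symmetric] algebra_simps)
    also have "\<dots> \<le> 2 powr q * 2 powr (j * (q - p)) *
        (2 powr (p + 1) * ((2 powr (p + 1) * D * m j) powr \<theta> * N j))"
      by (intro mult_left_mono rec_m) simp
    also have "\<dots> = c * N j * (2 powr (j * (q * \<theta>)) * m j powr \<theta>)"
      using D m0[of j] by (simp add: c q\<theta> powr_mult mult_ac)
    also have "2 powr (j * (q * \<theta>)) * m j powr \<theta> = a j powr \<theta>"
      using m0[of j] by (simp add: a_def powr_mult powr_powr mult_ac)
    finally show ?thesis .
  qed
  \<comment> \<open>Chebyshev's bound controls 2^(jp) m_j, and the remaining factor 2^(j(q-p))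
    increases with \<open>j\<close>.\<close>
  moreover have "bdd_above (a ` {..K})" for K
  proof (rule bdd_aboveI2)
    fix j assume "j \<in> {..K}"
    then have "2 powr (j * (q - p)) \<le> (2::real) powr (K * (q - p))"
      using pq by (intro powr_mono mult_right_mono) auto
    then have "2 powr (j * (q - p)) * (2 powr (j * p) * m j) \<le> 2 powr (K * (q - p)) * F"
      using m_F m0 by (intro mult_mono) auto
    then show "a j \<le> 2 powr (K * (q - p)) * F"
      by (simp add: a_def mult.assoc[symmetric] powr_add[symmetric] algebra_simps)
  qed
  ultimately have sum_a: "(\<Sum>j\<in>J. a j) \<le> (c * (2 * C * A) powr p) powr (1 / (1 - \<theta>))" if "finite J" for J
    using a0 c0 \<theta>0 \<theta>(2) sum_N that by (intro dyadic_iteration[of a N]) (auto simp: N_def)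

  define R where "R = 2 powr q * (c * (2 * C * A) powr p) powr (1 / (1 - \<theta>))"
  \<comment> \<open>Each nonzero value lies in a dyadic shell and is bounded by its upper end,
    whence the factor 2^q in \<open>R\<close>. \<open>int_decode\<close> enumerates the integers so
    that the sum is a series over the naturals.\<close>
  have "(\<integral>\<^sup>+x. ennreal (\<bar>f x\<bar> powr q) \<partial>M)
      \<le> (\<integral>\<^sup>+x. (\<Sum>n. ennreal (2 powr ((int_decode n + 1) * q)) * indicator (S (int_decode n)) x) \<partial>M)"
  proof (rule nn_integral_mono)
    fix x assume x: "x \<in> space M"
    let ?h = "\<lambda>n. ennreal (2 powr ((int_decode n + 1) * q)) * indicator (S (int_decode n)) x"
    show "ennreal (\<bar>f x\<bar> powr q) \<le> (\<Sum>n. ?h n)"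
    proof (cases "f x = 0")
      case False
      then obtain j :: int where j: "2 powr j \<le> \<bar>f x\<bar>" "\<bar>f x\<bar> \<le> 2 powr (j + 1)"
        using ex_dyadic[of "\<bar>f x\<bar>"] by auto
      have "\<bar>f x\<bar> powr q \<le> (2 powr (j + 1)) powr q"
        using j q0 by (intro powr_mono2) auto
      then have "ennreal (\<bar>f x\<bar> powr q) \<le> ?h (int_encode j)"
        using j x by (simp add: S_def powr_powr ennreal_leI)
      also have "\<dots> = (\<Sum>n\<in>{int_encode j}. ?h n)" by simp
      also have "\<dots> \<le> (\<Sum>n. ?h n)" by (intro sum_le_suminf) auto
      finally show ?thesis .
    qed simp
  qed
  also have "\<dots> = (\<Sum>n. \<integral>\<^sup>+x. ennreal (2 powr ((int_decode n + 1) * q)) * indicator (S (int_decode n)) x \<partial>M)"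
    by (rule nn_integral_suminf) measurable
  also have "\<dots> = (\<Sum>n. ennreal (2 powr q * a (int_decode n)))"
  proof (rule suminf_cong)
    fix n
    have "2 powr q * a (int_decode n) = 2 powr ((int_decode n + 1) * q) * m (int_decode n)"
      by (simp add: a_def powr_add[symmetric] algebra_simps)
    then show "(\<integral>\<^sup>+x. ennreal (2 powr ((int_decode n + 1) * q)) * indicator (S (int_decode n)) x \<partial>M)
        = ennreal (2 powr q * a (int_decode n))"
      using m0 by (simp add: nn_integral_cmult_indicator S_fin ennreal_mult')
  qed
  also have "\<dots> \<le> ennreal R"
  proof (rule suminf_le_const)
    fix n
    have "(\<Sum>i<n. 2 powr q * a (int_decode i)) = 2 powr q * (\<Sum>j\<in>int_decode ` {..<n}. a j)"
      by (simp add: sum.reindex inj_int_decode sum_distrib_left)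
    also have "\<dots> \<le> R"
      unfolding R_def by (intro mult_left_mono sum_a) auto
    finally show "(\<Sum>i<n. ennreal (2 powr q * a (int_decode i))) \<le> ennreal R"
      using a0 by (subst sum_ennreal) (auto intro: ennreal_leI)
  qed simp
  \<comment> \<open>With 1 / (1 - \<theta>) = q / p, the bound becomes an exact \<open>q\<close>-th
    power.\<close>
  also have "R = (4 * C * c powr (1 / p) * A) powr q"
  proof -
    have "1 / (1 - \<theta>) = q / p" using q p by simp
    then have "R = 2 powr q * (c powr (1 / p)) powr q * (2 * C * A) powr q"
      unfolding R_def using c0 C A(2) p by (simp add: powr_mult powr_powr)
    also have "\<dots> = (2 * c powr (1 / p) * (2 * C * A)) powr q"
      using C A(2) powr_mult[of 2 2 q] by (simp add: powr_mult)
    finally show ?thesis by (simp add: mult_ac)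
  qed
  finally show ?thesis
    using q0 C A(2) by (simp add: Lp_norm_def enn_powr_le_iff)
qed

theorem theorem1p1:
  fixes M :: "'a measure"
    and E :: "('a \<Rightarrow> real) \<Rightarrow> ('a \<Rightarrow> real) \<Rightarrow> real"
    and F :: "('a \<Rightarrow> real) set"
    and P :: "real \<Rightarrow> ('a \<Rightarrow> real) \<Rightarrow> 'a \<Rightarrow> real"
    and k :: "real \<Rightarrow> 'a \<Rightarrow> 'a \<Rightarrow> real"
    and p \<alpha> \<beta> :: real
  assumes "Dirichlet_space M E F"
    and "heat_semigroup M E F P"
    and "conservative M P"
    and "p \<ge> 1"
    and "heat_kernel M P k"
    and "\<beta> > 0"
    and "\<exists>C>0. \<forall>t>0. AE (x, y) in M \<Otimes>\<^sub>M M. k t x y \<le> C * t powr (- \<beta>)"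
    and "\<alpha> > 0"
    and "\<exists>C>0. \<forall>f\<in>Lp M (ennreal p).
           Besov_seminorm M k p \<alpha> f \<le> ennreal C * Liminf (at_right 0) (Besov_functional M k p \<alpha> f)"
    and "\<alpha> < \<beta>"
    and "p < \<beta> / \<alpha>"
  shows "\<exists>C>0. \<forall>f\<in>Lp M (ennreal p).
           Lp_norm M (ennreal (p * \<beta> / (\<beta> - p * \<alpha>))) f \<le> ennreal C * Besov_seminorm M k p \<alpha> f"
proof -
  define \<theta> where "\<theta> = p * \<alpha> / \<beta>"
  define q where "q = p / (1 - \<theta>)"
  have \<theta>: "\<theta> < 1" using assms(6,8,11) by (simp add: \<theta>_def field_simps)
  have q: "p * \<beta> / (\<beta> - p * \<alpha>) = q"
    using assms(6) \<theta> by (simp add: q_def \<theta>_def field_simps)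
  obtain D where D: "0 < D" "\<And>t. 0 < t \<Longrightarrow> AE (x, y) in M \<Otimes>\<^sub>M M. k t x y \<le> D * t powr (- \<beta>)"
    using assms(7) by blast
  obtain C where C: "0 < C" "\<And>f. f \<in> Lp M (ennreal p) \<Longrightarrow>
      Besov_seminorm M k p \<alpha> f \<le> ennreal C * Liminf (at_right 0) (Besov_functional M k p \<alpha> f)"
    using assms(9) by blast
  define c where "c = 2 powr q * 2 powr (p + 1) * (2 powr (p + 1) * D) powr \<theta>"
  have c0: "0 < c" using D by (simp add: c_def)
  have M: "sigma_finite_measure M" using assms(1) by (simp add: Dirichlet_space_def)
  have k0: "0 \<le> k t x y" if "0 < t" "x \<in> space M" "y \<in> space M" for t x y
    using assms(5) that unfolding heat_kernel_def by blast
  show ?thesis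
  proof (intro exI[of _ "4 * C * c powr (1 / p)"] conjI ballI)
    show "0 < 4 * C * c powr (1 / p)" using C c0 by simp
    fix f assume f: "f \<in> Lp M (ennreal p)"
    show "Lp_norm M (ennreal (p * \<beta> / (\<beta> - p * \<alpha>))) f
        \<le> ennreal (4 * C * c powr (1 / p)) * Besov_seminorm M k p \<alpha> f"
    \<comment> \<open>For an infinite seminorm the right side is infinite because the constant is
      positive.\<close>
    proof (cases "Besov_seminorm M k p \<alpha> f")
      case (real A)
      have "Lp_norm M (ennreal q) f \<le> ennreal (4 * C * c powr (1 / p) * A)"
        using real by (intro Lq_norm_le_of_Besov_le[OF M heat_kernel_measurable[OF assms(5)] k0
            heat_kernel_mass[OF assms(5,3)] D(2,1) C(1) assms(4,6,8) C(2) \<theta>_def \<theta> q_def c_def f]) auto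
      then show ?thesis using real C c0 by (simp add: q ennreal_mult')
    next
      case top
      then show ?thesis using C c0 by (simp add: ennreal_mult_top)
    qed
  qed
qed

end
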